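(* Let $(\gamma,\Gamma)$ be an ambiguous pair of closed smooth plane curves with parameter $L>0$, let $t$ be the arc length parameter on $\gamma$, and set $x(t)=\gamma(t)-L\gamma_t(t)$ and $y(t)=\gamma(t)+L\gamma_t(t)$, both of which lie on $\Gamma$. Then, as $t$ varies, the distance between the points $x$ and $y$ along the curve $\Gamma$ remains constant, and for each $t$ the segment $xy$ makes equal angles with $\Gamma$ at its two endpoints.
   Context: A bicycle is modeled by an oriented segment of fixed length $L$ that moves in the plane so as to remain tangent to the trajectory $\gamma$ of its rear endpoint; if $t$ is the arc length parameter on $\gamma$, the front endpoint traverses $\Gamma(t)=\gamma(t)+L\gamma_t(t)$. A pair of curves $(\gamma,\Gamma)$ is ambiguous if it can serve as the pair of trajectories of the rear and front wheels when traversed in each of the two opposite directions. Thus $t\mapsto\gamma(t)+L\gamma_t(t)$ and $t\mapsto\gamma(t)-L\gamma_t(t)$ both traverse the same curve $\Gamma$, in the same direction as $t$ increases. The distance along $\Gamma$ is the length of the arc of $\Gamma$ from $x$ to $y$, followed continuously. *)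

theory Defs
  imports "HOL-Analysis.Analysis"
begin

text \<open>
  The Euclidean plane is the type of complex numbers. A closed curve is a periodic map on the
  whole real line; it is oriented by its parameter.
\<close>

definition velocity :: "(real \<Rightarrow> complex) \<Rightarrow> real \<Rightarrow> complex" where
  "velocity c t = vector_derivative c (at t)"

definition smooth :: "(real \<Rightarrow> complex) \<Rightarrow> bool" where
  "smooth c \<longleftrightarrow> (\<forall>n t. (velocity ^^ n) c differentiable (at t))"

text \<open>Smooth curves are immersed, but may have self-intersections.\<close>

definition closed_smooth_curve :: "(real \<Rightarrow> complex) \<Rightarrow> bool" where
  "closed_smooth_curve c \<longleftrightarrow>
     smooth c \<and> (\<forall>t. velocity c t \<noteq> 0) \<and> (\<exists>P>0. \<forall>t. c (t + P) = c t)"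

definition arc_length_parametrized :: "(real \<Rightarrow> complex) \<Rightarrow> bool" where
  "arc_length_parametrized c \<longleftrightarrow> (\<forall>t. norm (velocity c t) = 1)"

definition reversed :: "(real \<Rightarrow> complex) \<Rightarrow> real \<Rightarrow> complex" where
  "reversed c t = c (- t)"

text \<open>Position of the front end of the bicycle; \<open>\<gamma>\<close> has to be parametrized by arc length.\<close>

definition front :: "real \<Rightarrow> (real \<Rightarrow> complex) \<Rightarrow> real \<Rightarrow> complex" where
  "front L \<gamma> t = \<gamma> t + L *\<^sub>R velocity \<gamma> t"

text \<open>
  \<open>traversal \<Gamma> c \<phi>\<close>: the moving point \<open>c t\<close> runs through the whole of \<open>\<Gamma>\<close> in its positive
  direction, and \<open>\<phi> t\<close> is its position followed continuously, as a parameter value of \<open>\<Gamma>\<close> that is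
  not reduced modulo the period. One period of \<open>c\<close> may correspond to several periods of \<open>\<Gamma>\<close>.
\<close>

definition traversal :: "(real \<Rightarrow> complex) \<Rightarrow> (real \<Rightarrow> complex) \<Rightarrow> (real \<Rightarrow> real) \<Rightarrow> bool" where
  "traversal \<Gamma> c \<phi> \<longleftrightarrow>
     continuous_on UNIV \<phi> \<and> strict_mono \<phi> \<and> surj \<phi> \<and> (\<forall>t. c t = \<Gamma> (\<phi> t))"

definition bicycle_tracks :: "real \<Rightarrow> (real \<Rightarrow> complex) \<Rightarrow> (real \<Rightarrow> complex) \<Rightarrow> bool" where
  "bicycle_tracks L \<gamma> \<Gamma> \<longleftrightarrow> (\<exists>\<phi>. traversal \<Gamma> (front L \<gamma>) \<phi>)"

text \<open>
  Since \<open>front L (reversed \<gamma>) (- t) = \<gamma> t - L *\<^sub>R velocity \<gamma> t\<close>, the second conjunct says that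
  \<open>\<gamma> t - L *\<^sub>R velocity \<gamma> t\<close> runs along \<open>\<Gamma>\<close> in its positive direction as \<open>t\<close> increases.
\<close>

definition ambiguous_pair :: "real \<Rightarrow> (real \<Rightarrow> complex) \<Rightarrow> (real \<Rightarrow> complex) \<Rightarrow> bool" where
  "ambiguous_pair L \<gamma> \<Gamma> \<longleftrightarrow>
     bicycle_tracks L \<gamma> \<Gamma> \<and> bicycle_tracks L (reversed \<gamma>) (reversed \<Gamma>)"

definition arc_length :: "(real \<Rightarrow> complex) \<Rightarrow> real \<Rightarrow> real \<Rightarrow> real" where
  "arc_length c a b = integral (closed_segment a b) (\<lambda>u. norm (velocity c u))"

text \<open>
  The signed angle, in \<open>(-\<pi>, \<pi>]\<close>, by which \<open>u\<close> has to be turned to point in the direction of \<open>v\<close>.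
  A chord from \<open>p\<close> to \<open>q\<close> makes equal angles with tangents \<open>u\<close> at \<open>p\<close> and \<open>v\<close> at \<open>q\<close> when
  \<open>oriented_angle u (q - p) = oriented_angle (q - p) v\<close>: the two tangent lines are then mirror
  images in the perpendicular bisector of the chord, and not parallel as they would be for
  \<open>oriented_angle u (q - p) = oriented_angle v (q - p)\<close>.
\<close>

definition oriented_angle :: "complex \<Rightarrow> complex \<Rightarrow> real" where
  "oriented_angle u v = Arg (v / u)"

end

theory Submission
  imports Defs
begin

text \<open>
  Writing \<open>\<gamma>'' = \<i>\<kappa>\<gamma>'\<close>, the front ends of the two directions of travel move with velocities \<open>y' = (1 + \<i>L\<kappa>)\<gamma>'\<close> and
  \<open>x' = (1 - \<i>L\<kappa>)\<gamma>'\<close>. These have the same norm, so both ends advance equally fast along \<open>\<Gamma>\<close>, and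
  they are mirror images of each other in the line spanned by \<open>y - x = 2L\<gamma>'\<close>.
\<close>

text \<open>A traversal provides only a continuous parameter; this is how differentiability is
  obtained for it. In Caratheodory's form the increment of \<open>f\<close> is a continuous slope
  times the increment of \<open>\<phi>\<close>. Near \<open>t\<close> that slope is close to
  \<open>a \<noteq> 0\<close>, so dividing by it leaves the difference quotient of
  \<open>\<phi>\<close>.\<close>

lemma DERIV_of_comp:
  fixes f \<phi> :: "'a::real_normed_field \<Rightarrow> 'a"
  assumes cont: "isCont \<phi> t"
    and f: "DERIV f (\<phi> t) :> a" and "a \<noteq> 0"
    and comp: "DERIV (\<lambda>s. f (\<phi> s)) t :> b"
  shows "DERIV \<phi> t :> b / a"
proof -
  obtain g where g: "\<And>z. f z - f (\<phi> t) = g z * (z - \<phi> t)" "isCont g (\<phi> t)" "g (\<phi> t) = a"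
    using f unfolding CARAT_DERIV by auto
  have g_lim: "((\<lambda>s. g (\<phi> s)) \<longlongrightarrow> a) (at t)"
    using isCont_o2[OF cont g(2)] g(3) by (simp add: isCont_def)
  have "((\<lambda>s. ((f (\<phi> s) - f (\<phi> t)) / (s - t)) / g (\<phi> s)) \<longlongrightarrow> b / a) (at t)"
    using comp unfolding has_field_derivative_iff
    by (intro tendsto_divide g_lim \<open>a \<noteq> 0\<close>)
  moreover have "\<forall>\<^sub>F s in at t. ((f (\<phi> s) - f (\<phi> t)) / (s - t)) / g (\<phi> s) = (\<phi> s - \<phi> t) / (s - t)"
    using tendsto_imp_eventually_ne[OF g_lim \<open>a \<noteq> 0\<close>]
    by eventually_elim (simp add: g(1))
  ultimately show ?thesis
    unfolding has_field_derivative_iff by (rule Lim_transform_eventually)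
qed

lemma smooth_has_velocity:
  assumes "smooth c"
  shows "(c has_vector_derivative velocity c t) (at t)"
  using assms[unfolded smooth_def, rule_format, of 0 t]
  by (simp add: velocity_def vector_derivative_works)

lemma smooth_velocity: "smooth c \<Longrightarrow> smooth (velocity c)"
  unfolding smooth_def using funpow_Suc_right[of _ velocity] by (metis comp_apply)

lemma isCont_velocity: "smooth c \<Longrightarrow> isCont (velocity c) t"
  using has_vector_derivative_continuous smooth_has_velocity smooth_velocity by blast

text \<open>Differentiating \<open>velocity \<gamma> s \<bullet> velocity \<gamma> s = 1\<close>
  makes the acceleration orthogonal to the velocity, and in the complex plane that means a real
  multiple of \<i> times the velocity. The factor \<kappa> is the signed curvature.\<close>

lemma unit_speed_acceleration:
  assumes "smooth \<gamma>" "arc_length_parametrized \<gamma>"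
  obtains \<kappa> where "velocity (velocity \<gamma>) t = \<i> * of_real \<kappa> * velocity \<gamma> t"
proof -
  let ?T = "velocity \<gamma> t" and ?A = "velocity (velocity \<gamma>) t"
  have unit: "velocity \<gamma> s \<bullet> velocity \<gamma> s = 1" for s
    using assms(2) by (simp add: arc_length_parametrized_def dot_square_norm)
  have T: "(velocity \<gamma> has_derivative (\<lambda>h. h *\<^sub>R ?A)) (at t)"
    using smooth_has_velocity[OF smooth_velocity[OF assms(1)]]
    by (simp add: has_vector_derivative_def)
  have "((\<lambda>s. velocity \<gamma> s \<bullet> velocity \<gamma> s) has_derivative
          (\<lambda>h. ?T \<bullet> (h *\<^sub>R ?A) + (h *\<^sub>R ?A) \<bullet> ?T)) (at t)"
    by (rule has_derivative_inner[OF T T])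
  moreover have "((\<lambda>s. velocity \<gamma> s \<bullet> velocity \<gamma> s) has_derivative (\<lambda>h. 0)) (at t)"
    by (simp add: unit)
  ultimately have "(\<lambda>h. ?T \<bullet> (h *\<^sub>R ?A) + (h *\<^sub>R ?A) \<bullet> ?T) = (\<lambda>h. 0)"
    by (rule has_derivative_unique)
  from fun_cong[OF this, of 1] have "?A \<bullet> ?T = 0"
    by (simp add: inner_commute)
  then have "Re (?A * cnj ?T) = 0"
    by (simp add: inner_complex_def)
  then have "?A * cnj ?T = \<i> * of_real (Im (?A * cnj ?T))"
    by (simp add: complex_eq_iff)
  \<comment> \<open>For a unit vector the conjugate is the inverse, so \<open>?A\<close> is
    recovered as \<open>(?A * cnj ?T) * ?T\<close>.\<close>
  moreover have "cnj ?T * ?T = 1"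
    using unit[of t] by (simp add: complex_norm_square[symmetric] mult.commute dot_square_norm)
  ultimately have "?A = \<i> * of_real (Im (?A * cnj ?T)) * ?T"
    by (metis mult.assoc mult.right_neutral)
  then show thesis by (rule that)
qed

lemma front_has_vector_derivative:
  assumes "smooth \<gamma>" "velocity (velocity \<gamma>) t = \<i> * of_real \<kappa> * velocity \<gamma> t"
  shows "((\<lambda>s. \<gamma> s + L *\<^sub>R velocity \<gamma> s) has_vector_derivative
           Complex 1 (L * \<kappa>) * velocity \<gamma> t) (at t)"
proof -
  have "((\<lambda>s. \<gamma> s + L *\<^sub>R velocity \<gamma> s) has_vector_derivative
          velocity \<gamma> t + L *\<^sub>R velocity (velocity \<gamma>) t) (at t)"
    by (auto intro!: derivative_eq_intros smooth_has_velocity smooth_velocity assms(1))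
  then show ?thesis
    by (simp add: assms(2) scaleR_conv_of_real Complex_eq algebra_simps)
qed

text \<open>Where \<open>c\<close> moves with nonzero velocity, its position along \<Gamma> advances
  at a definite positive rate \<open>d\<close>. Monotonicity of \<phi> gives
  \<open>d \<ge> 0\<close>, and \<open>v \<noteq> 0\<close> excludes \<open>d = 0\<close>.\<close>

lemma traversal_has_derivative:
  assumes \<Gamma>: "smooth \<Gamma>" "\<And>t. velocity \<Gamma> t \<noteq> 0"
    and trav: "traversal \<Gamma> c \<phi>"
    and c: "(c has_vector_derivative v) (at t)" "v \<noteq> 0"
  obtains d where "d > 0" "(\<phi> has_real_derivative d) (at t)" "v = of_real d * velocity \<Gamma> (\<phi> t)"
proof -
  let ?w = "velocity \<Gamma> (\<phi> t)"
  have cont: "isCont \<phi> t" and mono: "strict_mono \<phi>" and eq: "\<And>s. c s = \<Gamma> (\<phi> s)"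
    using trav by (auto simp: traversal_def continuous_on_eq_continuous_at)
  have inner_deriv: "((\<lambda>s. h s \<bullet> ?w) has_real_derivative h' \<bullet> ?w) (at r)"
    if "(h has_vector_derivative h') (at r)" for h h' r
    using bounded_linear.has_vector_derivative[OF bounded_linear_inner_left that]
    by (simp add: has_real_derivative_iff_has_vector_derivative)
  have c': "((\<lambda>s. \<Gamma> (\<phi> s)) has_vector_derivative v) (at t)"
    using c(1) by (simp add: eq[symmetric])
  \<comment> \<open>Project onto the tangent to get a real function that is locally invertible near \<open>\<phi> t\<close>.\<close>
  define d where "d = (v \<bullet> ?w) / (?w \<bullet> ?w)"
  have d: "(\<phi> has_real_derivative d) (at t)"
    unfolding d_def
    by (rule DERIV_of_comp[where f = "\<lambda>u. \<Gamma> u \<bullet> ?w", OF cont])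
       (use \<Gamma> c' in \<open>auto intro!: inner_deriv smooth_has_velocity\<close>)
  \<comment> \<open>The projection has determined only the tangential component of \<open>v\<close>.
    Now that \<phi> is differentiable, the chain rule shows that \<open>v\<close> has no other
    component.\<close>
  have "((\<Gamma> \<circ> \<phi>) has_vector_derivative d *\<^sub>R ?w) (at t)"
    using d smooth_has_velocity[OF \<Gamma>(1)]
    by (intro vector_diff_chain_at) (simp_all add: has_real_derivative_iff_has_vector_derivative)
  then have v: "v = of_real d * ?w"
    using c' vector_derivative_unique_at by (fastforce simp: o_def scaleR_conv_of_real)
  have "d \<ge> 0"
    using strict_mono_mono[OF mono] d by (rule mono_on_imp_deriv_nonneg) simp
  with v c(2) have "d > 0" by (cases "d = 0") auto
  then show thesis using d v by (rule that)
qed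

text \<open>\<open>arc_length\<close> integrates over an unordered segment, hence the absolute
  value. Since \<open>F\<close> is an antiderivative on the whole line, \<open>F b - F a\<close> is
  a signed length that can be differentiated in both ends without knowing their order.\<close>

lemma arc_length_antiderivative:
  assumes "smooth c"
  obtains F where "\<And>u. (F has_real_derivative norm (velocity c u)) (at u)"
    and "\<And>a b. arc_length c a b = \<bar>F b - F a\<bar>"
proof -
  have "isCont (\<lambda>u. norm (velocity c u)) u" for u
    using isCont_velocity[OF assms] by (rule continuous_norm)
  then obtain F where F: "\<And>u. (F has_vector_derivative norm (velocity c u)) (at u)"
    using einterval_antiderivative[of "-\<infinity>" \<infinity> "\<lambda>u. norm (velocity c u)"] by auto
  have int: "((\<lambda>u. norm (velocity c u)) has_integral F b - F a) {a..b}" if "a \<le> b" for a b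
    using that F by (intro fundamental_theorem_of_calculus)
      (auto intro: has_vector_derivative_at_within)
  have "integral {a..b} (\<lambda>u. norm (velocity c u)) = \<bar>F b - F a\<bar>" if "a \<le> b" for a b
    using integral_unique[OF int[OF that]] has_integral_nonneg[OF int[OF that]] by simp
  then have "arc_length c a b = \<bar>F b - F a\<bar>" for a b
    by (auto simp: arc_length_def closed_segment_eq_real_ivl abs_minus_commute)
  with F show thesis
    by (intro that[of F]) (simp_all add: has_real_derivative_iff_has_vector_derivative)
qed

text \<open>The two sign changes, in time and in the parameter of the curve, cancel in the
  orientation. This turns the second half of \<open>ambiguous_pair\<close> into a positive traversal
  of \<Gamma> by \<open>x\<close>.\<close>

lemma traversal_of_reversed:
  assumes "traversal (reversed \<Gamma>) c \<phi>"
  shows "traversal \<Gamma> (reversed c) (\<lambda>t. - \<phi> (- t))"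
proof -
  have \<phi>: "continuous_on UNIV \<phi>" "strict_mono \<phi>" "surj \<phi>" "\<And>t. c t = \<Gamma> (- \<phi> t)"
    using assms by (auto simp: traversal_def reversed_def)
  have "continuous_on UNIV (\<lambda>t. - \<phi> (- t))"
    by (intro continuous_intros continuous_on_compose2[OF \<phi>(1)]) auto
  moreover have "strict_mono (\<lambda>t. - \<phi> (- t))"
    using \<phi>(2) by (auto simp: strict_mono_def)
  moreover have "surj (\<lambda>t. - \<phi> (- t))"
    using \<phi>(3) by (metis minus_minus surj_def)
  ultimately show ?thesis
    by (simp add: traversal_def reversed_def \<phi>(4))
qed

lemma velocity_reversed:
  assumes "smooth c"
  shows "velocity (reversed c) t = - velocity c (- t)"
proof -
  have "((c \<circ> uminus) has_vector_derivative (-1) *\<^sub>R velocity c (- t)) (at t)"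
    by (intro vector_diff_chain_at smooth_has_velocity assms)
       (auto intro!: derivative_eq_intros)
  moreover have "c \<circ> uminus = reversed c"
    by (simp add: fun_eq_iff reversed_def)
  ultimately show ?thesis
    unfolding velocity_def[of "reversed c"] by (simp add: vector_derivative_at)
qed

theorem corollary2p5:
  fixes L :: real and \<gamma> \<Gamma> x y :: "real \<Rightarrow> complex"
  assumes "L > 0"
    and "closed_smooth_curve \<gamma>" and "closed_smooth_curve \<Gamma>"
    and "arc_length_parametrized \<gamma>"
    and "ambiguous_pair L \<gamma> \<Gamma>"
    and "\<And>t. x t = \<gamma> t - L *\<^sub>R velocity \<gamma> t"
    and "\<And>t. y t = \<gamma> t + L *\<^sub>R velocity \<gamma> t"
  shows "(\<exists>\<psi>. traversal \<Gamma> x \<psi>) \<and> (\<exists>\<phi>. traversal \<Gamma> y \<phi>) \<and>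
         (\<forall>\<psi> \<phi>. traversal \<Gamma> x \<psi> \<and> traversal \<Gamma> y \<phi> \<longrightarrow>
           (\<lambda>t. arc_length \<Gamma> (\<psi> t) (\<phi> t)) constant_on UNIV \<and>
           (\<forall>t. oriented_angle (velocity \<Gamma> (\<psi> t)) (y t - x t) =
                oriented_angle (y t - x t) (velocity \<Gamma> (\<phi> t))))"
proof -
  have \<gamma>: "smooth \<gamma>" "\<And>t. velocity \<gamma> t \<noteq> 0" and \<Gamma>: "smooth \<Gamma>" "\<And>t. velocity \<Gamma> t \<noteq> 0"
    using assms(2,3) by (auto simp: closed_smooth_curve_def)
  have y: "y = front L \<gamma>" and x: "x = reversed (front L (reversed \<gamma>))"
    by (auto simp: fun_eq_iff assms(6,7) front_def velocity_reversed[OF \<gamma>(1)] reversed_def)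
  have "\<exists>\<psi>. traversal \<Gamma> x \<psi>" "\<exists>\<phi>. traversal \<Gamma> y \<phi>"
    using assms(5) traversal_of_reversed unfolding x y ambiguous_pair_def bicycle_tracks_def
    by blast+
  moreover have "(\<lambda>t. arc_length \<Gamma> (\<psi> t) (\<phi> t)) constant_on UNIV \<and>
      (\<forall>t. oriented_angle (velocity \<Gamma> (\<psi> t)) (y t - x t) =
           oriented_angle (y t - x t) (velocity \<Gamma> (\<phi> t)))"
    if \<psi>: "traversal \<Gamma> x \<psi>" and \<phi>: "traversal \<Gamma> y \<phi>" for \<psi> \<phi>
  proof -
    \<comment> \<open>Here \<open>k\<close> is \<open>L\<close> times the curvature, and
      \<open>p\<close>, \<open>q\<close> are the rates of the two parameters on \<Gamma>. Both
      claims rest on the conjugate factors: their equal moduli give the constant distance, their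
      opposite arguments the equal angles.\<close>
    have ends: "\<exists>k p q. p > 0 \<and> q > 0 \<and>
        (\<psi> has_real_derivative p) (at t) \<and> (\<phi> has_real_derivative q) (at t) \<and>
        cnj (Complex 1 k) * velocity \<gamma> t = of_real p * velocity \<Gamma> (\<psi> t) \<and>
        Complex 1 k * velocity \<gamma> t = of_real q * velocity \<Gamma> (\<phi> t)" for t
    proof -
      obtain \<kappa> where \<kappa>: "velocity (velocity \<gamma>) t = \<i> * of_real \<kappa> * velocity \<gamma> t"
        using unit_speed_acceleration[OF \<gamma>(1) assms(4)] .
      \<comment> \<open>The real part 1 keeps the factor away from zero, so neither end ever
        stops.\<close>
      have nz: "Complex 1 k * velocity \<gamma> t \<noteq> 0" for k
        using \<gamma>(2) by (simp add: Complex_eq_0)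
      have "(y has_vector_derivative Complex 1 (L * \<kappa>) * velocity \<gamma> t) (at t)"
        using front_has_vector_derivative[OF \<gamma>(1) \<kappa>, of L] by (simp add: assms(7)[symmetric])
      from traversal_has_derivative[OF \<Gamma> \<phi> this nz] obtain q where
        q: "q > 0" "(\<phi> has_real_derivative q) (at t)"
          "Complex 1 (L * \<kappa>) * velocity \<gamma> t = of_real q * velocity \<Gamma> (\<phi> t)" .
      have "(x has_vector_derivative Complex 1 (- L * \<kappa>) * velocity \<gamma> t) (at t)"
        using front_has_vector_derivative[OF \<gamma>(1) \<kappa>, of "- L"] by (simp add: assms(6)[symmetric])
      from traversal_has_derivative[OF \<Gamma> \<psi> this nz] obtain p where
        p: "p > 0" "(\<psi> has_real_derivative p) (at t)"
          "Complex 1 (- L * \<kappa>) * velocity \<gamma> t = of_real p * velocity \<Gamma> (\<psi> t)" .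
      have "cnj (Complex 1 (L * \<kappa>)) = Complex 1 (- L * \<kappa>)"
        by (simp add: complex_eq_iff)
      with p q show ?thesis by metis
    qed
    obtain F where F: "\<And>u. (F has_real_derivative norm (velocity \<Gamma> u)) (at u)"
      and len: "\<And>a b. arc_length \<Gamma> a b = \<bar>F b - F a\<bar>"
      using arc_length_antiderivative[OF \<Gamma>(1)] by blast
    have "((\<lambda>t. F (\<phi> t) - F (\<psi> t)) has_real_derivative 0) (at t)" for t
    proof -
      obtain k p q where pq: "p > 0" "q > 0"
        "(\<psi> has_real_derivative p) (at t)" "(\<phi> has_real_derivative q) (at t)"
        "cnj (Complex 1 k) * velocity \<gamma> t = of_real p * velocity \<Gamma> (\<psi> t)"
        "Complex 1 k * velocity \<gamma> t = of_real q * velocity \<Gamma> (\<phi> t)"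
        using ends[of t] by blast
      \<comment> \<open>Both sides equal the modulus of
        \<open>Complex 1 k * velocity \<gamma> t\<close>, since conjugating the first factor does
        not change it.\<close>
      have "norm (velocity \<Gamma> (\<phi> t)) * q = norm (velocity \<Gamma> (\<psi> t)) * p"
        using pq(1,2) arg_cong[OF pq(5), of norm] arg_cong[OF pq(6), of norm]
        by (simp add: norm_mult mult.commute)
      then show ?thesis
        using DERIV_diff[OF DERIV_chain2[OF F pq(4)] DERIV_chain2[OF F pq(3)]] by simp
    qed
    then have "F (\<phi> t) - F (\<psi> t) = F (\<phi> 0) - F (\<psi> 0)" for t
      by (intro DERIV_isconst_all) auto
    then have "(\<lambda>t. arc_length \<Gamma> (\<psi> t) (\<phi> t)) constant_on UNIV"
      unfolding constant_on_def len by metis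
    moreover have "oriented_angle (velocity \<Gamma> (\<psi> t)) (y t - x t) =
        oriented_angle (y t - x t) (velocity \<Gamma> (\<phi> t))" for t
    proof -
      obtain k p q where pq: "p > 0" "q > 0"
        "cnj (Complex 1 k) * velocity \<gamma> t = of_real p * velocity \<Gamma> (\<psi> t)"
        "Complex 1 k * velocity \<gamma> t = of_real q * velocity \<Gamma> (\<phi> t)"
        using ends[of t] by blast
      \<comment> \<open>Turning from the tangent at \<open>x\<close> to the chord, and from the
        chord to the tangent at \<open>y\<close>, will both turn out to be multiplication by a
        positive multiple of \<open>z\<close>.\<close>
      define z where "z = Complex 1 k"
      have z: "z \<noteq> 0" by (simp add: z_def complex_eq_iff)
      have w: "velocity \<Gamma> (\<psi> t) = cnj z * velocity \<gamma> t / of_real p"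
        "velocity \<Gamma> (\<phi> t) = z * velocity \<gamma> t / of_real q"
        using pq by (simp_all add: z_def)
      have chord: "y t - x t = of_real (2 * L) * velocity \<gamma> t"
        by (simp add: assms(6,7) scaleR_conv_of_real)
      have "(y t - x t) / velocity \<Gamma> (\<psi> t) = of_real (2 * L * p) / cnj z"
        unfolding w chord using \<gamma>(2) z pq(1) by (simp add: field_simps)
      \<comment> \<open>Dividing by \<open>cnj z\<close> is multiplying by \<open>z\<close> and
        dividing by the squared modulus; the positive real factor then disappears under
        \<open>Arg\<close>.\<close>
      also have "\<dots> = of_real (2 * L * p / (norm z)\<^sup>2) * z"
        using z complex_norm_square[of z] by (simp add: field_simps)
      finally have "Arg ((y t - x t) / velocity \<Gamma> (\<psi> t)) = Arg z"
        using z assms(1) pq(1) Arg_times_of_real[of "2 * L * p / (norm z)\<^sup>2" z] by (simp del: of_real_mult of_real_divide of_real_power)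
      moreover have "velocity \<Gamma> (\<phi> t) / (y t - x t) = of_real (1 / (2 * L * q)) * z"
        unfolding w chord using \<gamma>(2) assms(1) pq(2) by (simp add: field_simps)
      then have "Arg (velocity \<Gamma> (\<phi> t) / (y t - x t)) = Arg z"
        using assms(1) pq(2) by (simp del: of_real_mult of_real_divide)
      ultimately show ?thesis by (simp add: oriented_angle_def)
    qed
    ultimately show ?thesis by blast
  qed
  ultimately show ?thesis by blast
qed

end
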